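(* Let $G$ be an amenable topological group and let $d$ be a continuous left-invariant écart on $G$. Assume that either $d$ is bounded or that $G$ has no non-trivial continuous homomorphisms to $\mathbb{R}$. Then, for all finite subsets $E\subseteq G$ and all $\epsilon>0$, there are $h_1,\ldots,h_n\in G$ such that $$\min_{\sigma\in\mathrm{Sym}(n)}\ \frac1n\sum_{i=1}^n d(h_ig,h_{\sigma(i)})<\epsilon$$ for all $g\in E$.
   Context: A topological group $G$ is amenable if every continuous affine action of $G$ on a non-empty compact convex subset of a locally convex topological vector space has a fixed point. Equivalently, there is a mean $\mathfrak m$ (positive linear functional of norm $1$ with $\mathfrak m(\mathbf 1)=1$) on the algebra $\mathsf{LUCB}(G)$ of bounded functions $\phi:G\to\mathbb R$ for which $g\mapsto\phi(\,\cdot\,g)$ is continuous in the sup norm, such that $\mathfrak m(\phi(\,\cdot\, g))=\mathfrak m(\phi)$ for all $g\in G$. An écart (pseudometric) is like a metric except that $d(x,y)=0$ is allowed for $x\neq y$. $\mathrm{Sym}(n)$ is the group of permutations of $\{1,\ldots,n\}$; the elements $h_1,\ldots,h_n$ need not be distinct. *)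

theory Defs
  imports "HOL-Analysis.Analysis" "HOL-Combinatorics.Permutations"
begin

text \<open>
  Topological groups are the types of class \<^class>\<open>topological_group_add\<close>.  This class is written
  additively but assumes neither commutativity nor the Hausdorff property, so \<open>x + y\<close> is the
  product \<open>xy\<close> of an arbitrary group.
\<close>

definition LUCB :: "('a::topological_group_add \<Rightarrow> real) set" where
  "LUCB = {\<phi>. bounded (range \<phi>) \<and>
     (\<forall>g. uniform_limit UNIV (\<lambda>h x. \<phi> (x + h)) (\<lambda>x. \<phi> (x + g)) (at g))}"

text \<open>
  A functional on \<open>LUCB\<close> is represented by a function on all of \<open>'a \<Rightarrow> real\<close>; its values outside
  \<open>LUCB\<close> are irrelevant.  Its norm is at most \<open>1\<close> by the fourth conjunct, hence equal to \<open>1\<close>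
  by the last one.
\<close>

definition mean_on_LUCB :: "(('a::topological_group_add \<Rightarrow> real) \<Rightarrow> real) \<Rightarrow> bool" where
  "mean_on_LUCB m \<longleftrightarrow>
     (\<forall>\<phi>\<in>LUCB. \<forall>\<psi>\<in>LUCB. m (\<lambda>x. \<phi> x + \<psi> x) = m \<phi> + m \<psi>) \<and>
     (\<forall>c. \<forall>\<phi>\<in>LUCB. m (\<lambda>x. c * \<phi> x) = c * m \<phi>) \<and>
     (\<forall>\<phi>\<in>LUCB. (\<forall>x. 0 \<le> \<phi> x) \<longrightarrow> 0 \<le> m \<phi>) \<and>
     (\<forall>\<phi>\<in>LUCB. \<bar>m \<phi>\<bar> \<le> (SUP x. \<bar>\<phi> x\<bar>)) \<and>
     m (\<lambda>_. 1) = 1"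

text \<open>
  Amenability is defined by an invariant mean: the fixed-point property quantifies over all
  locally convex spaces, hence over types, which HOL cannot do inside a definition.
\<close>

definition amenable :: "'a::topological_group_add itself \<Rightarrow> bool" where
  "amenable _ \<longleftrightarrow>
     (\<exists>m :: ('a \<Rightarrow> real) \<Rightarrow> real. mean_on_LUCB m \<and>
        (\<forall>\<phi>\<in>LUCB. \<forall>g. m (\<lambda>x. \<phi> (x + g)) = m \<phi>))"

definition ecart :: "('a \<Rightarrow> 'a \<Rightarrow> real) \<Rightarrow> bool" where
  "ecart d \<longleftrightarrow>
     (\<forall>x y. 0 \<le> d x y) \<and> (\<forall>x. d x x = 0) \<and> (\<forall>x y. d x y = d y x) \<and>
     (\<forall>x y z. d x z \<le> d x y + d y z)"

definition left_invariant :: "('a::plus \<Rightarrow> 'a \<Rightarrow> real) \<Rightarrow> bool" where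
  "left_invariant d \<longleftrightarrow> (\<forall>g x y. d (g + x) (g + y) = d x y)"

definition continuous_real_hom :: "('a::topological_group_add \<Rightarrow> real) \<Rightarrow> bool" where
  "continuous_real_hom f \<longleftrightarrow>
     (\<forall>x y. f (x + y) = f x + f y) \<and> continuous_on UNIV f"

end

theory Submission
  imports Defs "HOL-Library.Function_Algebras"
begin

text \<open>
  If no finite multiset \<open>H\<close> can be carried to its translates \<open>H g\<close>, \<open>g \<in> E\<close>, at total cost below
  \<open>\<epsilon> |H|\<close>, then a Hahn--Banach argument over the integers yields functions \<open>f\<^sub>g\<close>, 1-Lipschitz for \<open>d\<close>, with
  \<open>\<Sum>g\<in>E. f\<^sub>g (x g) - f\<^sub>g x \<ge> \<epsilon>\<close> for all \<open>x\<close>.  The increments of a 1-Lipschitz function lie in LUCB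
  although the function itself need not, and their means form a continuous homomorphism to the reals,
  which vanishes under either hypothesis; so the sum has mean \<open>0\<close>, a contradiction.  The triangle
  inequality turns a cheap flow from \<open>H\<close> to \<open>H g\<close> into a matching that is no more expensive.
\<close>

section \<open>Additive functionals dominated by a submonoid of upper bounds\<close>

text \<open>
  Extending the submonoid \<open>K\<close> by the multiples of a pair must, by maximality, produce some \<open>(0, x)\<close> with
  \<open>x < 0\<close>.  If this happens for both \<open>(w, r)\<close> and its negative, cross-multiplying the two witnesses
  eliminates the pair and gives such an element in \<open>K\<close> itself.
\<close>

lemma maximal_submonoid_total:
  fixes K :: "('b::comm_ring_1 \<times> real) set"
  assumes zero: "(0, 0) \<in> K"
    and add: "\<And>v r w s. (v, r) \<in> K \<Longrightarrow> (w, s) \<in> K \<Longrightarrow> (v + w, r + s) \<in> K"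
    and nonneg: "\<And>r. (0, r) \<in> K \<Longrightarrow> 0 \<le> r"
    and maximal: "\<And>L. K \<subseteq> L \<Longrightarrow> L \<subseteq> D \<times> UNIV \<Longrightarrow>
      (\<And>v r w s. (v, r) \<in> L \<Longrightarrow> (w, s) \<in> L \<Longrightarrow> (v + w, r + s) \<in> L) \<Longrightarrow>
      (\<And>r. (0, r) \<in> L \<Longrightarrow> 0 \<le> r) \<Longrightarrow> L = K"
    and KD: "K \<subseteq> D \<times> UNIV"
    and D0: "0 \<in> D" and Dadd: "\<And>v w. v \<in> D \<Longrightarrow> w \<in> D \<Longrightarrow> v + w \<in> D" and Dminus: "\<And>v. v \<in> D \<Longrightarrow> - v \<in> D"
    and "w \<in> D"
  shows "(w, r) \<in> K \<or> (- w, - r) \<in> K"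
proof -
  have mult: "(of_nat n * v, real n * s) \<in> K" if "(v, s) \<in> K" for n v s
  proof (induction n)
    case (Suc n)
    show ?case using add[OF that Suc] by (simp add: distrib_right)
  qed (simp add: zero)
  have multD: "of_nat n * v \<in> D" if "v \<in> D" for n v
  proof (induction n)
    case (Suc n)
    show ?case using Dadd[OF that Suc] by (simp add: distrib_right)
  qed (simp add: D0)
  have witness: "\<exists>n s. (- (of_nat n * v), s) \<in> K \<and> s + real n * t < 0"
    if v: "v \<in> D" and notin: "(v, t) \<notin> K" for v t
  proof (rule ccontr)
    assume no: "\<not> ?thesis"
    define L where "L = {(u + of_nat n * v, s + real n * t) | u s n. (u, s) \<in> K}"
    have sub: "K \<subseteq> L"
    proof
      fix p assume "p \<in> K"
      then have "p = (fst p + of_nat 0 * v, snd p + real 0 * t)" "(fst p, snd p) \<in> K" by auto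
      then show "p \<in> L" unfolding L_def by blast
    qed
    have "L = K"
    proof (rule maximal)
      show "K \<subseteq> L" by (rule sub)
      show "L \<subseteq> D \<times> UNIV" using KD Dadd multD[OF v] by (auto simp: L_def)
      fix a x b y assume "(a, x) \<in> L" "(b, y) \<in> L"
      then obtain u s n u' s' n' where e: "a = u + of_nat n * v" "x = s + real n * t" "(u, s) \<in> K"
        "b = u' + of_nat n' * v" "y = s' + real n' * t" "(u', s') \<in> K" unfolding L_def by auto
      have "a + b = (u + u') + of_nat (n + n') * v" "x + y = (s + s') + real (n + n') * t"
        using e by (auto simp: algebra_simps)
      then show "(a + b, x + y) \<in> L" unfolding L_def using add[OF e(3,6)] by blast
    next
      fix x assume "(0, x) \<in> L"
      then obtain u s n where e: "0 = u + of_nat n * v" "x = s + real n * t" "(u, s) \<in> K"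
        unfolding L_def by auto
      then have "u = - (of_nat n * v)" by (simp add: eq_neg_iff_add_eq_0)
      with e no show "0 \<le> x" by force
    qed
    moreover have "(v, t) \<in> L"
      unfolding L_def by (rule CollectI, rule exI[of _ 0], rule exI[of _ 0], rule exI[of _ 1]) (simp add: zero)
    ultimately show False using notin by simp
  qed
  show ?thesis
  proof (rule ccontr)
    assume c: "\<not> ?thesis"
    obtain n s where n: "(- (of_nat n * w), s) \<in> K" "s + real n * r < 0"
      using witness[of w r] c \<open>w \<in> D\<close> by auto
    obtain m t where m: "(- (of_nat m * - w), t) \<in> K" "t + real m * (- r) < 0"
      using witness[of "- w" "- r"] c Dminus[OF \<open>w \<in> D\<close>] by auto
    have "of_nat m * - (of_nat n * w) + of_nat n * - (of_nat m * - w) = 0"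
      by (simp add: algebra_simps)
    then have "(0, real m * s + real n * t) \<in> K"
      using add[OF mult[OF n(1), of m] mult[OF m(1), of n]] by simp
    then have ge: "0 \<le> real m * s + real n * t" by (rule nonneg)
    \<comment> \<open>With \<open>n = 0\<close> the witness would be some \<open>(0, s)\<close> in
      \<open>K\<close> with \<open>s < 0\<close>, and likewise for \<open>m\<close>. Positive
      multipliers keep both inequalities strict.\<close>
    have "n > 0" using n nonneg by (cases n) force+
    moreover have "m > 0" using m nonneg by (cases m) force+
    ultimately have "real m * (s + real n * r) < 0" "real n * (t + real m * (- r)) < 0"
      using mult_pos_neg[OF _ n(2), of "real m"] mult_pos_neg[OF _ m(2), of "real n"] by simp_all
    with ge show False by (simp add: algebra_simps)
  qed
qed

text \<open>Zorn's lemma enlarges \<open>K\<close> to a maximal submonoid \<open>M\<close> with no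
  negative number over \<open>0\<close>. The infimum of the fibre of \<open>M\<close> over
  \<open>w\<close> is subadditive because \<open>M\<close> is closed under sums; totality of
  \<open>M\<close> gives \<open>f (- w) \<le> - f w\<close>, and hence additivity.\<close>

lemma additive_functional_below:
  fixes K :: "('b::comm_ring_1 \<times> real) set"
  assumes zero: "(0, 0) \<in> K"
    and add: "\<And>v r w s. (v, r) \<in> K \<Longrightarrow> (w, s) \<in> K \<Longrightarrow> (v + w, r + s) \<in> K"
    and minus: "\<And>w. w \<in> fst ` K \<Longrightarrow> - w \<in> fst ` K"
    and nonneg: "\<And>r. (0, r) \<in> K \<Longrightarrow> 0 \<le> r"
  obtains f :: "'b \<Rightarrow> real" where
    "\<And>v w. v \<in> fst ` K \<Longrightarrow> w \<in> fst ` K \<Longrightarrow> f (v + w) = f v + f w"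
    "\<And>w r. (w, r) \<in> K \<Longrightarrow> f w \<le> r"
proof -
  define D where "D = fst ` K"
  have D0: "0 \<in> D" using zero by (force simp: D_def)
  have Dadd: "v + w \<in> D" if "v \<in> D" "w \<in> D" for v w
    using that add by (force simp: D_def)
  define F where "F = {L. K \<subseteq> L \<and> L \<subseteq> D \<times> UNIV \<and>
    (\<forall>v r w s. (v, r) \<in> L \<longrightarrow> (w, s) \<in> L \<longrightarrow> (v + w, r + s) \<in> L) \<and> (\<forall>r. (0, r) \<in> L \<longrightarrow> 0 \<le> r)}"
  have "K \<in> F" using add nonneg by (force simp: F_def D_def)
  have "\<exists>M\<in>F. \<forall>L\<in>F. M \<subseteq> L \<longrightarrow> L = M"
  proof (rule subset_Zorn_nonempty)
    show "F \<noteq> {}" using \<open>K \<in> F\<close> by auto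
    fix \<C> assume ne: "\<C> \<noteq> {}" and ch: "subset.chain F \<C>"
    then have C: "\<C> \<subseteq> F" and lin: "\<And>X Y. X \<in> \<C> \<Longrightarrow> Y \<in> \<C> \<Longrightarrow> X \<subseteq> Y \<or> Y \<subseteq> X"
      by (auto simp: subset_chain_def)
    have "(v + w, r + s) \<in> \<Union>\<C>" if vw: "(v, r) \<in> \<Union>\<C>" "(w, s) \<in> \<Union>\<C>" for v r w s
    proof -
      obtain X Y where XY: "X \<in> \<C>" "Y \<in> \<C>" "(v, r) \<in> X" "(w, s) \<in> Y" using vw by auto
      obtain Z where "Z \<in> \<C>" "(v, r) \<in> Z" "(w, s) \<in> Z"
        using lin[OF XY(1,2)] XY by blast
      moreover from this C have "(v + w, r + s) \<in> Z" unfolding F_def by blast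
      ultimately show ?thesis by blast
    qed
    moreover have "K \<subseteq> \<Union>\<C>" "\<Union>\<C> \<subseteq> D \<times> UNIV" "\<forall>r. (0, r) \<in> \<Union>\<C> \<longrightarrow> 0 \<le> r"
      using C ne unfolding F_def by blast+
    ultimately show "\<Union>\<C> \<in> F" unfolding F_def by blast
  qed
  then obtain M where M: "M \<in> F" "\<And>L. L \<in> F \<Longrightarrow> M \<subseteq> L \<Longrightarrow> L = M" by blast
  have KM: "K \<subseteq> M" and MD: "M \<subseteq> D \<times> UNIV"
    and Madd: "\<And>v r w s. (v, r) \<in> M \<Longrightarrow> (w, s) \<in> M \<Longrightarrow> (v + w, r + s) \<in> M"
    and Mnn: "\<And>r. (0, r) \<in> M \<Longrightarrow> 0 \<le> r" using M(1) unfolding F_def by blast+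
  have total: "(w, r) \<in> M \<or> (- w, - r) \<in> M" if "w \<in> D" for w r
  proof (rule maximal_submonoid_total[where D = D])
    show "L = M" if "M \<subseteq> L" "L \<subseteq> D \<times> UNIV" "\<And>v r w s. (v, r) \<in> L \<Longrightarrow> (w, s) \<in> L \<Longrightarrow> (v + w, r + s) \<in> L"
      "\<And>r. (0, r) \<in> L \<Longrightarrow> 0 \<le> r" for L
      using M(2)[of L] that KM unfolding F_def by blast
  qed (use zero KM MD Madd Mnn D0 Dadd minus that in \<open>auto simp: D_def\<close>)
  define f where "f w = Inf {r. (w, r) \<in> M}" for w
  have ne: "{r. (w, r) \<in> M} \<noteq> {}" if "w \<in> D" for w using that KM by (auto simp: D_def)
  have sum_nonneg: "0 \<le> r + s" if "(w, r) \<in> M" "(- w, s) \<in> M" for w r s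
    using Madd[OF that] Mnn by simp
  have bdd: "bdd_below {r. (w, r) \<in> M}" if "w \<in> D" for w
  proof -
    have "- w \<in> D" using minus that by (simp add: D_def)
    then obtain s where "(- w, s) \<in> M" using ne by blast
    then show ?thesis by (intro bdd_belowI[of _ "- s"]) (use sum_nonneg in force)
  qed
  have le: "f w \<le> r" if "(w, r) \<in> M" for w r
    unfolding f_def using that MD bdd by (intro cInf_lower) auto
  have sub: "f (v + w) \<le> f v + f w" if "v \<in> D" "w \<in> D" for v w
  proof -
    have "f (v + w) - r \<le> f v" if r: "(w, r) \<in> M" for r
      unfolding f_def[of v]
      by (rule cInf_greatest[OF ne[OF \<open>v \<in> D\<close>]]) (use le[OF Madd[OF _ r]] in force)
    then have "f (v + w) - f v \<le> f w"
      unfolding f_def[of w] by (intro cInf_greatest ne \<open>w \<in> D\<close>) force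
    then show ?thesis by simp
  qed
  \<comment> \<open>For \<open>x > - f w\<close> the pair \<open>(w, - x)\<close> lies below the
    infimum, so totality puts \<open>(- w, x)\<close> into \<open>M\<close>.\<close>
  have neg: "f (- w) \<le> - f w" if "w \<in> D" for w
  proof (rule dense_ge)
    fix x assume "- f w < x"
    then have "(w, - x) \<notin> M" using le[of w "- x"] by auto
    then show "f (- w) \<le> x" using total[OF that, of "- x"] le by auto
  qed
  show thesis
  proof
    fix v w assume "v \<in> fst ` K" "w \<in> fst ` K"
    then have vw: "v \<in> D" "w \<in> D" "- w \<in> D" using minus by (auto simp: D_def)
    have "f v \<le> f (v + w) + f (- w)" using sub[OF Dadd[OF vw(1,2)] vw(3)] by simp
    then show "f (v + w) = f v + f w" using sub[OF vw(1,2)] neg[OF vw(2)] by simp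
  qed (use le KM in auto)
qed

section \<open>Flows and matchings of finite multisets\<close>

text \<open>Deleting the edge \<open>(x, y)\<close> of the flow leaves a matching that ends at \<open>x\<close> and starts at \<open>y\<close>; its
  edges \<open>(a, x)\<close> and \<open>(y, b)\<close> are replaced by \<open>(a, b)\<close>.\<close>

lemma matching_of_flow:
  fixes d :: "'a \<Rightarrow> 'a \<Rightarrow> real"
  assumes d: "ecart d"
    and "A + image_mset snd P = B + image_mset fst P"
  shows "\<exists>M. image_mset fst M = A \<and> image_mset snd M = B \<and>
    (\<Sum>(x, y)\<in>#M. d x y) \<le> (\<Sum>(x, y)\<in>#P. d x y)"
  using assms(2)
proof (induction P arbitrary: A B)
  case empty
  have "d x x = 0" for x using d by (simp add: ecart_def)
  then show ?case using empty
    by (intro exI[of _ "image_mset (\<lambda>x. (x, x)) A"]) (simp add: image_mset.compositionality o_def)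
next
  case (add p P)
  have tri: "d x z \<le> d x y + d y z" and nn: "0 \<le> d x y" for x y z
    using d by (auto simp: ecart_def)
  obtain x y where p: "p = (x, y)" by force
  have "add_mset y A + image_mset snd P = add_mset x B + image_mset fst P"
    using add.prems p by simp
  from add.IH[OF this] obtain M where M: "image_mset fst M = add_mset y A"
    "image_mset snd M = add_mset x B" and cost: "(\<Sum>(x, y)\<in>#M. d x y) \<le> (\<Sum>(x, y)\<in>#P. d x y)"
    by blast
  have "y \<in># image_mset fst M" using M by simp
  then obtain b where yb: "(y, b) \<in># M" by auto
  define N where "N = M - {#(y, b)#}"
  have MN: "M = add_mset (y, b) N" using yb by (simp add: N_def)
  show ?case
  proof (cases "b = x")
    \<comment> \<open>A single edge of \<open>M\<close> starts at \<open>y\<close> and ends at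
      \<open>x\<close>; it is simply dropped.\<close>
    case True
    then show ?thesis using M cost nn[of x y] nn[of y b] MN p by (intro exI[of _ N]) auto
  next
    case False
    then have "x \<in># image_mset snd N" using M(2) MN
      by (metis add_mset_remove_trivial_If image_mset_add_mset insert_noteq_member snd_conv)
    then obtain a where "(a, x) \<in># N" by auto
    define N' where "N' = N - {#(a, x)#}"
    have NN: "N = add_mset (a, x) N'" using \<open>(a, x) \<in># N\<close> by (simp add: N'_def)
    have "d a b \<le> d a x + d x y + d y b" using tri[of a b x] tri[of x b y] by simp
    then show ?thesis using M cost MN NN p
      by (intro exI[of _ "add_mset (a, b) N'"]) (auto simp: add_mset_commute)
  qed
qed

text \<open>Peeling off one pair with first entry \<open>f i\<close> for each index labels a
  matching by \<open>I\<close>, even when \<open>f\<close> repeats values.\<close>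

lemma mset_pairs_eq_image:
  assumes "finite I" "image_mset fst M = image_mset f (mset_set I)"
  shows "\<exists>b. M = image_mset (\<lambda>i. (f i, b i)) (mset_set I)"
  using assms
proof (induction I arbitrary: M)
  case empty
  then show ?case by simp
next
  case (insert i I)
  have "f i \<in># image_mset fst M" using insert by simp
  then obtain y where y: "(f i, y) \<in># M" by auto
  define N where "N = M - {#(f i, y)#}"
  have MN: "M = add_mset (f i, y) N" using y by (simp add: N_def)
  obtain b where b: "N = image_mset (\<lambda>i. (f i, b i)) (mset_set I)"
    using insert.IH[of N] insert MN by auto
  have "image_mset (\<lambda>j. (f j, (b(i := y)) j)) (mset_set I) = N"
    unfolding b using insert.hyps by (intro image_mset_cong) auto
  then show ?case using insert.hyps MN by (intro exI[of _ "b(i := y)"]) simp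
qed

text \<open>Once the matching is labelled by \<open>I\<close> on the left, its right ends and
  \<open>v\<close> are two families on \<open>I\<close> with the same multiset of values, so they
  differ by a permutation of \<open>I\<close>.\<close>

lemma permutation_of_flow:
  fixes d :: "'a \<Rightarrow> 'a \<Rightarrow> real"
  assumes "ecart d" "finite I"
    and "image_mset u (mset_set I) + image_mset snd P = image_mset v (mset_set I) + image_mset fst P"
  shows "\<exists>\<sigma>. \<sigma> permutes I \<and> (\<Sum>i\<in>I. d (u i) (v (\<sigma> i))) \<le> (\<Sum>(x, y)\<in>#P. d x y)"
proof -
  obtain M where M: "image_mset fst M = image_mset u (mset_set I)"
    "image_mset snd M = image_mset v (mset_set I)"
    "(\<Sum>(x, y)\<in>#M. d x y) \<le> (\<Sum>(x, y)\<in>#P. d x y)"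
    using matching_of_flow[OF assms(1,3)] by blast
  obtain b where b: "M = image_mset (\<lambda>i. (u i, b i)) (mset_set I)"
    using mset_pairs_eq_image[OF assms(2) M(1)] by blast
  have "image_mset b (mset_set I) = image_mset v (mset_set I)"
    using M(2) b by (simp add: image_mset.compositionality o_def)
  then obtain \<sigma> where \<sigma>: "\<sigma> permutes I" "\<forall>i\<in>I. b i = v (\<sigma> i)"
    using image_mset_eq_implies_permutes[OF assms(2)] by metis
  have "(\<Sum>(x, y)\<in>#M. d x y) = (\<Sum>i\<in>I. d (u i) (b i))"
    by (simp add: b image_mset.compositionality o_def sum_unfold_sum_mset)
  then show ?thesis using M(3) \<sigma> by (intro exI[of _ \<sigma>]) simp
qed


section \<open>Duality between flows and Lipschitz functions\<close>

text \<open>One \<open>H\<close> must serve every \<open>g\<close>, so the balances for all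
  \<open>g\<close> are recorded together. If no zero balance has negative cost, an additive
  functional below the costs exists, and its values on single edges are the differences of the
  functions \<open>f g\<close>.\<close>

lemma lipschitz_family_or_flow:
  fixes d :: "'a \<Rightarrow> 'a \<Rightarrow> real" and T :: "'c \<Rightarrow> 'a \<Rightarrow> 'a"
  assumes "finite E"
  shows "(\<exists>f. (\<forall>g\<in>E. \<forall>x y. f g x - f g y \<le> d x y) \<and>
           (\<forall>x. \<epsilon> \<le> (\<Sum>g\<in>E. f g (T g x) - f g x))) \<or>
         (\<exists>H P. (\<forall>g\<in>E. image_mset (T g) H + image_mset snd (P g) = H + image_mset fst (P g)) \<and>
           (\<Sum>g\<in>E. \<Sum>(x, y)\<in>#P g. d x y) < \<epsilon> * real (size H))"
proof -
  \<comment> \<open>\<open>K\<close> consists of the balances \<open>W\<close> of flow \<open>P\<close> against displaced mass \<open>H\<close>, paired with their costs; a flow solving the problem is a pair \<open>(0, r)\<close> with \<open>r < 0\<close>.\<close>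
  define W :: "'a multiset \<Rightarrow> ('c \<Rightarrow> ('a \<times> 'a) multiset) \<Rightarrow> 'c \<Rightarrow> 'a \<Rightarrow> int"
    where "W H P = (\<lambda>g x. if g \<in> E then
      int (count (image_mset fst (P g)) x) - int (count (image_mset snd (P g)) x)
      - int (count (image_mset (T g) H) x) + int (count H x) else 0)" for H P
  define C where "C H P = (\<Sum>g\<in>E. \<Sum>(x, y)\<in>#P g. d x y) - \<epsilon> * real (size H)"
    for H :: "'a multiset" and P :: "'c \<Rightarrow> ('a \<times> 'a) multiset"
  define K where "K = {(W H P, C H P) | H P. True}"
  have W_add: "W H P + W H' P' = W (H + H') (\<lambda>g. P g + P' g)" for H P H' P'
    by (auto simp: W_def fun_eq_iff)
  have C_add: "C H P + C H' P' = C (H + H') (\<lambda>g. P g + P' g)" for H P H' P'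
    by (simp add: C_def sum.distrib algebra_simps)
  have W_0: "W {#} (\<lambda>_. {#}) = 0" and C_0: "C {#} (\<lambda>_. {#}) = 0"
    by (auto simp: W_def C_def fun_eq_iff)
  \<comment> \<open>Reversing the edges negates their balance, and the edges
    \<open>(T g x, x)\<close> replace the mass \<open>H\<close>. The cost may change: only the set
    of balances has to be closed under negation.\<close>
  have W_minus: "- W H P = W {#} (\<lambda>g. image_mset prod.swap (P g) + image_mset (\<lambda>x. (T g x, x)) H)" for H P
    by (auto simp: W_def fun_eq_iff image_mset.compositionality o_def)
  have K_intro: "(W H P, C H P) \<in> K" for H P unfolding K_def by blast
  have W_in: "W H P \<in> fst ` K" for H P using K_intro by force
  show ?thesis
  proof (cases "\<forall>r. (0, r) \<in> K \<longrightarrow> 0 \<le> r")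
    case False
    then obtain H P where HP: "W H P = 0" "C H P < 0" by (auto simp: K_def)
    have "image_mset (T g) H + image_mset snd (P g) = H + image_mset fst (P g)" if "g \<in> E" for g
    proof (rule multiset_eqI)
      fix x
      have "W H P g x = 0" using HP(1) by simp
      then show "count (image_mset (T g) H + image_mset snd (P g)) x = count (H + image_mset fst (P g)) x"
        using that unfolding W_def by (simp del: count_image_mset)
    qed
    then show ?thesis using HP(2) unfolding C_def by (intro disjI2 exI[of _ H] exI[of _ P]) simp
  next
    case True
    obtain F where F_add: "\<And>v w. v \<in> fst ` K \<Longrightarrow> w \<in> fst ` K \<Longrightarrow> F (v + w) = F v + F w"
      and F_le: "\<And>w r. (w, r) \<in> K \<Longrightarrow> F w \<le> r"
    proof (rule additive_functional_below[of K])
      show "(0, 0) \<in> K" using W_0 C_0 K_intro by metis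
      show "(v + w, r + s) \<in> K" if vw: "(v, r) \<in> K" "(w, s) \<in> K" for v r w s
      proof -
        obtain H P H' P' where "v = W H P" "r = C H P" "w = W H' P'" "s = C H' P'"
          using vw unfolding K_def by blast
        then show ?thesis unfolding K_def by (simp only: W_add C_add) blast
      qed
      show "- w \<in> fst ` K" if w: "w \<in> fst ` K" for w
      proof -
        obtain H P where "w = W H P" using w unfolding K_def by force
        then show ?thesis using W_minus W_in by simp
      qed
    qed (use True in auto)
    define e where "e g p = W {#} (\<lambda>k. if k = g then {#p#} else {#})" for g p
    have F_e_le: "F (e g (x, y)) \<le> d x y" if "g \<in> E" for g x y
    proof -
      have "(\<Sum>k\<in>E. \<Sum>(x, y)\<in>#(if k = g then {#(x, y)#} else {#}). d x y) = (\<Sum>k\<in>E. if k = g then d x y else 0)"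
        by (intro sum.cong) auto
      then have "C {#} (\<lambda>k. if k = g then {#(x, y)#} else {#}) = d x y"
        using assms that by (simp add: C_def)
      then have "(e g (x, y), d x y) \<in> K" unfolding e_def using K_intro by metis
      then show ?thesis by (rule F_le)
    qed
    have e_in: "e g p \<in> fst ` K" for g p unfolding e_def by (rule W_in)
    \<comment> \<open>The contributions at \<open>y\<close> cancel, so \<open>F\<close> on edges is
      a difference of potentials.\<close>
    have F_e_split: "F (e g (x, z)) = F (e g (x, y)) + F (e g (y, z))" for g x y z
    proof -
      have "e g (x, z) = e g (x, y) + e g (y, z)"
        by (auto simp: e_def W_def fun_eq_iff)
      then show ?thesis using F_add e_in by simp
    qed
    have F_0: "F 0 = 0" using F_add[of 0 0] W_0 W_in[of "{#}" "\<lambda>_. {#}"] by simp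
    have F_sum: "F (W {#} (\<lambda>k. if k \<in> S then {#p k#} else {#})) = (\<Sum>g\<in>S. F (e g (p g)))"
      if "finite S" for S p
      using that
    proof induction
      case empty
      show ?case by (simp only: empty_iff if_False W_0 F_0 sum.empty)
    next
      case (insert g S)
      have "W {#} (\<lambda>k. if k \<in> insert g S then {#p k#} else {#}) =
          e g (p g) + W {#} (\<lambda>k. if k \<in> S then {#p k#} else {#})"
        unfolding e_def W_add using insert.hyps by (intro arg_cong2[of _ _ _ _ W]) auto
      then show ?case by (simp only: F_add[OF e_in W_in] insert.IH sum.insert[OF insert.hyps])
    qed
    \<comment> \<open>The potential is measured from the arbitrary base point
      \<open>undefined\<close>; only differences of \<open>f g\<close> matter.\<close>
    define f where "f g x = F (e g (x, undefined))" for g x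
    have f_diff: "f g x - f g y = F (e g (x, y))" for g x y
      unfolding f_def using F_e_split[of g x undefined y] by simp
    have "\<epsilon> \<le> (\<Sum>g\<in>E. f g (T g x) - f g x)" for x
    proof -
      \<comment> \<open>One unit of mass at \<open>x\<close> has cost \<open>- \<epsilon>\<close>,
        and the edges \<open>(T k x, x)\<close> cancel its balance; so \<open>F\<close> is at least
        \<open>\<epsilon>\<close> on these edges.\<close>
      let ?P = "\<lambda>k. if k \<in> E then {#(T k x, x)#} else {#}"
      have "W {#x#} (\<lambda>_. {#}) + W {#} ?P = 0"
        unfolding W_add by (auto simp: W_def fun_eq_iff)
      then have "F (W {#x#} (\<lambda>_. {#})) + F (W {#} ?P) = 0"
        using F_add[OF W_in[of "{#x#}" "\<lambda>_. {#}"] W_in[of "{#}" ?P]] F_0 by metis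
      moreover have "(W {#x#} (\<lambda>_. {#}), - \<epsilon>) \<in> K"
      proof -
        have "C {#x#} (\<lambda>_. {#}) = - \<epsilon>" by (simp add: C_def)
        then show ?thesis using K_intro by metis
      qed
      ultimately have "\<epsilon> \<le> F (W {#} ?P)" using F_le by fastforce
      then show ?thesis using F_sum[OF assms, of "\<lambda>k. (T k x, x)"] by (simp add: f_diff)
    qed
    then show ?thesis using F_e_le f_diff by (intro disjI1 exI[of _ f]) simp
  qed
qed

section \<open>Closure properties of \<open>LUCB\<close> and basic properties of means\<close>

lemma LUCB_const: "(\<lambda>_. c) \<in> LUCB"
  by (simp add: LUCB_def uniform_limit_const)

lemma LUCB_add: "\<phi> \<in> LUCB \<Longrightarrow> \<psi> \<in> LUCB \<Longrightarrow> (\<lambda>x. \<phi> x + \<psi> x) \<in> LUCB"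
  unfolding LUCB_def by (auto intro!: bounded_plus_comp uniform_limit_add)

lemma LUCB_sum: "(\<And>i. i \<in> I \<Longrightarrow> \<phi> i \<in> LUCB) \<Longrightarrow> (\<lambda>x. \<Sum>i\<in>I. \<phi> i x) \<in> LUCB"
  by (induction I rule: infinite_finite_induct) (simp_all add: LUCB_const LUCB_add)

lemma mean_add:
  assumes "mean_on_LUCB m" "\<phi> \<in> LUCB" "\<psi> \<in> LUCB"
  shows "m (\<lambda>x. \<phi> x + \<psi> x) = m \<phi> + m \<psi>"
  using assms by (simp add: mean_on_LUCB_def)

lemma mean_nonneg:
  assumes "mean_on_LUCB m" "\<phi> \<in> LUCB" "\<And>x. 0 \<le> \<phi> x"
  shows "0 \<le> m \<phi>"
  using assms by (simp add: mean_on_LUCB_def)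

lemma mean_const:
  assumes "mean_on_LUCB m"
  shows "m (\<lambda>_. c) = c"
proof -
  have "m (\<lambda>x. c * \<phi> x) = c * m \<phi>" if "\<phi> \<in> LUCB" for \<phi>
    using assms that by (simp add: mean_on_LUCB_def)
  from this[OF LUCB_const[of 1]] show ?thesis using assms by (simp add: mean_on_LUCB_def)
qed

lemma mean_sum:
  assumes "mean_on_LUCB m" "\<And>i. i \<in> I \<Longrightarrow> \<phi> i \<in> LUCB"
  shows "m (\<lambda>x. \<Sum>i\<in>I. \<phi> i x) = (\<Sum>i\<in>I. m (\<phi> i))"
  using assms(2)
  by (induction I rule: infinite_finite_induct)
    (simp_all add: mean_const[OF assms(1)] mean_add[OF assms(1)] LUCB_sum)

lemma mean_abs_le:
  assumes "mean_on_LUCB m" "\<phi> \<in> LUCB" "\<And>x. \<bar>\<phi> x\<bar> \<le> B"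
  shows "\<bar>m \<phi>\<bar> \<le> B"
proof -
  have "\<bar>m \<phi>\<bar> \<le> (SUP x. \<bar>\<phi> x\<bar>)" using assms unfolding mean_on_LUCB_def by blast
  also have "\<dots> \<le> B" using assms(3) by (intro cSUP_least) auto
  finally show ?thesis .
qed

section \<open>Increments of a Lipschitz function and their means\<close>

context
  fixes d :: "'a::topological_group_add \<Rightarrow> 'a \<Rightarrow> real" and f :: "'a \<Rightarrow> real"
  assumes ecart: "ecart d"
    and cont: "continuous_on UNIV (\<lambda>(x, y). d x y)"
    and left_invariant: "left_invariant d"
    and lipschitz: "\<And>x y. f x - f y \<le> d x y"
begin

text \<open>Right translation by \<open>g\<close> need not preserve \<open>d\<close>, so continuity
  of \<open>d\<close> and of the group operation is used instead.\<close>

lemma ecart_tendsto_0: "((\<lambda>h. d (h + g) (k + g)) \<longlongrightarrow> 0) (at k)"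
proof -
  have "continuous_on UNIV (\<lambda>h. d (h + g) (k + g))"
    using continuous_on_compose2[OF cont, of UNIV "\<lambda>h. (h + g, k + g)"]
    by (simp add: continuous_intros)
  then have "((\<lambda>h. d (h + g) (k + g)) \<longlongrightarrow> d (k + g) (k + g)) (at k)"
    by (simp add: continuous_on_def)
  then show ?thesis using ecart by (simp add: ecart_def)
qed

text \<open>Left invariance removes \<open>x\<close> from the Lipschitz bound, which makes it
  uniform in \<open>x\<close>.\<close>

lemma abs_increment_le: "\<bar>f (x + g) - f (x + k)\<bar> \<le> d g k"
proof -
  have "d (x + g) (x + k) = d g k" "d (x + k) (x + g) = d g k"
    using left_invariant ecart unfolding left_invariant_def ecart_def by metis+
  then show ?thesis using lipschitz[of "x + g" "x + k"] lipschitz[of "x + k" "x + g"] by (simp add: abs_le_iff)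
qed

text \<open>Replacing the translation \<open>l\<close> by \<open>h\<close> changes the increment by
  at most \<open>d (h + g) (l + g) + d (h + k) (l + k)\<close>, which does not depend on
  \<open>x\<close> and tends to \<open>0\<close>.\<close>

lemma increment_in_LUCB: "(\<lambda>x. f (x + g) - f (x + k)) \<in> LUCB"
proof -
  have "bounded (range (\<lambda>x. f (x + g) - f (x + k)))"
    using abs_increment_le by (intro boundedI[of _ "d g k"]) auto
  moreover have "uniform_limit UNIV (\<lambda>h x. f (x + h + g) - f (x + h + k))
    (\<lambda>x. f (x + l + g) - f (x + l + k)) (at l)" for l
  proof (rule uniform_limitI)
    fix e :: real assume "e > 0"
    have "((\<lambda>h. d (h + g) (l + g) + d (h + k) (l + k)) \<longlongrightarrow> 0 + 0) (at l)"
      by (intro tendsto_add ecart_tendsto_0)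
    then have "\<forall>\<^sub>F h in at l. d (h + g) (l + g) + d (h + k) (l + k) < e"
      using \<open>e > 0\<close> by (auto intro: order_tendstoD)
    then show "\<forall>\<^sub>F h in at l. \<forall>x\<in>UNIV. dist (f (x + h + g) - f (x + h + k)) (f (x + l + g) - f (x + l + k)) < e"
    proof eventually_elim
      case (elim h)
      show ?case
      proof
        fix x
        show "dist (f (x + h + g) - f (x + h + k)) (f (x + l + g) - f (x + l + k)) < e"
          using elim abs_increment_le[of x "h + g" "l + g"] abs_increment_le[of x "h + k" "l + k"]
          unfolding dist_real_def add.assoc by linarith
      qed
    qed
  qed
  ultimately show ?thesis by (simp add: LUCB_def)
qed

text \<open>The mean increment is a continuous homomorphism \<open>\<phi>\<close> with \<open>\<bar>\<phi> g\<bar> \<le> d g 0\<close>; if \<open>d\<close> is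
  bounded, it is a bounded homomorphism to the reals.\<close>

lemma mean_increment_eq_0:
  assumes mean: "mean_on_LUCB m"
    and invariant: "\<And>\<phi> g. \<phi> \<in> LUCB \<Longrightarrow> m (\<lambda>x. \<phi> (x + g)) = m \<phi>"
    and alternative: "bounded (range (\<lambda>(x, y). d x y)) \<or>
         (\<forall>f :: 'a \<Rightarrow> real. continuous_real_hom f \<longrightarrow> (\<forall>x. f x = 0))"
  shows "m (\<lambda>x. f (x + g) - f x) = 0"
proof -
  \<comment> \<open>Writing \<open>x + 0\<close> makes this the case \<open>k = 0\<close> of
    \<open>increment_in_LUCB\<close>.\<close>
  define \<phi> where "\<phi> g = m (\<lambda>x. f (x + g) - f (x + 0))" for g
  have diff: "\<phi> g = m (\<lambda>x. f (x + g) - f (x + k)) + \<phi> k" for g k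
  proof -
    have "m (\<lambda>x. (f (x + g) - f (x + k)) + (f (x + k) - f (x + 0))) =
        m (\<lambda>x. f (x + g) - f (x + k)) + m (\<lambda>x. f (x + k) - f (x + 0))"
      by (rule mean_add[OF mean increment_in_LUCB increment_in_LUCB])
    then show ?thesis by (simp add: \<phi>_def)
  qed
  \<comment> \<open>The increment from \<open>x + a\<close> to \<open>x + a + b\<close> is a right
    translate of the increment by \<open>b\<close>, so it has the same mean.\<close>
  have hom: "\<phi> (a + b) = \<phi> a + \<phi> b" for a b
    using diff[of "a + b" a] invariant[OF increment_in_LUCB[of b 0], of a]
    by (simp add: \<phi>_def add.assoc)
  have le: "\<bar>\<phi> g - \<phi> k\<bar> \<le> d g k" for g k
    using diff[of g k] mean_abs_le[OF mean increment_in_LUCB abs_increment_le, of g k] by simp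
  have "\<phi> g = 0"
    using alternative
  proof
    assume no_hom: "\<forall>f :: 'a \<Rightarrow> real. continuous_real_hom f \<longrightarrow> (\<forall>x. f x = 0)"
    have "(\<phi> \<longlongrightarrow> \<phi> k) (at k)" for k
    proof (rule LIM_zero_cancel, rule Lim_null_comparison)
      show "((\<lambda>h. d h k) \<longlongrightarrow> 0) (at k)" using ecart_tendsto_0[of 0 k] by simp
    qed (use le in auto)
    then have "continuous_on UNIV \<phi>" by (simp add: continuous_on_def)
    then show ?thesis using no_hom hom by (simp add: continuous_real_hom_def)
  next
    assume "bounded (range (\<lambda>(x, y). d x y))"
    then obtain B where B: "\<And>x y. \<bar>d x y\<bar> \<le> B" by (force simp: bounded_iff)
    have "\<phi> 0 = 0" using hom[of 0 0] by simp
    \<comment> \<open>The iterate is the \<open>n\<close>-th power of \<open>g\<close> in additive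
      notation; linear growth along powers contradicts boundedness unless
      \<open>\<phi> g = 0\<close>.\<close>
    have "\<phi> (((+) g ^^ n) 0) = real n * \<phi> g" for n
      by (induction n) (simp_all add: \<open>\<phi> 0 = 0\<close> hom algebra_simps)
    then have bound: "real n * \<bar>\<phi> g\<bar> \<le> B" for n
      using le[of "((+) g ^^ n) 0" 0] B[of "((+) g ^^ n) 0" 0] \<open>\<phi> 0 = 0\<close> by (simp add: abs_mult)
    show ?thesis
    proof (rule ccontr)
      assume "\<phi> g \<noteq> 0"
      then obtain n where "B < real n * \<bar>\<phi> g\<bar>" using reals_Archimedean3[of "\<bar>\<phi> g\<bar>"] by auto
      then show False using bound[of n] by simp
    qed
  qed
  then show ?thesis by (simp add: \<phi>_def)
qed

end

section \<open>From the mean to a finite family\<close>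

theorem corollary1p2:
  fixes d :: "'a::topological_group_add \<Rightarrow> 'a \<Rightarrow> real"
    and E :: "'a set" and \<epsilon> :: real
  assumes "amenable TYPE('a)"
    and "ecart d"
    and "continuous_on UNIV (\<lambda>(x, y). d x y)"
    and "left_invariant d"
    and "bounded (range (\<lambda>(x, y). d x y)) \<or>
         (\<forall>f :: 'a \<Rightarrow> real. continuous_real_hom f \<longrightarrow> (\<forall>x. f x = 0))"
    and "finite E"
    and "\<epsilon> > 0"
  shows "\<exists>n::nat. \<exists>h :: nat \<Rightarrow> 'a. n \<ge> 1 \<and>
    (\<forall>g\<in>E. Min ((\<lambda>\<sigma>. (1 / real n) * (\<Sum>i=1..n. d (h i + g) (h (\<sigma> i)))) ` {\<sigma>. \<sigma> permutes {1..n}}) < \<epsilon>)"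
proof -
  obtain m where mean: "mean_on_LUCB m"
    and invariant: "\<And>\<phi> g. \<phi> \<in> LUCB \<Longrightarrow> m (\<lambda>x. \<phi> (x + g)) = m (\<phi> :: 'a \<Rightarrow> real)"
    using assms(1) unfolding amenable_def by blast
  have no_family: False if f: "\<And>g x y. g \<in> E \<Longrightarrow> f g x - f g y \<le> d x y"
    and ge: "\<And>x. \<epsilon> \<le> (\<Sum>g\<in>E. f g (x + g) - f g x)" for f :: "'a \<Rightarrow> 'a \<Rightarrow> real"
  proof -
    let ?S = "\<lambda>x. \<Sum>g\<in>E. f g (x + g) - f g x"
    have in_LUCB: "(\<lambda>x. f g (x + g) - f g x) \<in> LUCB" if "g \<in> E" for g
      using increment_in_LUCB[OF assms(2-4) f, of g g 0] that by simp
    have "m (\<lambda>x. f g (x + g) - f g x) = 0" if "g \<in> E" for g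
      using mean_increment_eq_0[OF assms(2-4) f mean invariant assms(5), of g g] that by simp
    then have "m ?S = 0" using mean_sum[OF mean in_LUCB, of E] by simp
    moreover have "m (\<lambda>x. ?S x + (- \<epsilon>)) = m ?S + m (\<lambda>_. - \<epsilon>)"
      by (rule mean_add[OF mean LUCB_sum[OF in_LUCB] LUCB_const])
    moreover have "0 \<le> m (\<lambda>x. ?S x + (- \<epsilon>))"
    proof -
      have "(\<lambda>x. ?S x + (- \<epsilon>)) \<in> LUCB" using LUCB_sum[OF in_LUCB, of E] LUCB_const by (intro LUCB_add) auto
      moreover have "\<forall>x. 0 \<le> ?S x + (- \<epsilon>)" using ge by simp
      ultimately show ?thesis using mean mean_nonneg by blast
    qed
    ultimately show False using mean_const[OF mean, of "- \<epsilon>"] \<open>\<epsilon> > 0\<close> by linarith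
  qed
  have nn: "0 \<le> (\<Sum>(x, y)\<in>#P. d x y)" for P
    using assms(2) by (induction P) (auto simp: ecart_def)
  obtain H P where flow: "\<And>g. g \<in> E \<Longrightarrow>
      image_mset (\<lambda>x. x + g) H + image_mset snd (P g) = H + image_mset fst (P g)"
    and cost: "(\<Sum>g\<in>E. \<Sum>(x, y)\<in>#P g. d x y) < \<epsilon> * real (size H)"
    using lipschitz_family_or_flow[OF assms(6), of d \<epsilon> "\<lambda>g x. x + g"] no_family by blast
  define n where "n = size H"
  have "0 \<le> (\<Sum>g\<in>E. \<Sum>(x, y)\<in>#P g. d x y)" by (intro sum_nonneg nn)
  \<comment> \<open>For empty \<open>H\<close> the strict inequality \<open>cost\<close> would make
    a sum of nonnegative costs negative.\<close>
  then have "n \<ge> 1" using cost by (cases n) (auto simp: n_def)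
  obtain xs where xs: "mset xs = H" by (metis ex_mset)
  \<comment> \<open>The shift by one reconciles list positions from \<open>0\<close> with
    permutations of \<open>{1..n}\<close>.\<close>
  define h where "h i = xs ! (i - 1)" for i
  have "map h [1..<Suc n] = xs"
    using xs by (intro nth_equalityI) (auto simp: h_def n_def simp del: upt_Suc)
  then have "image_mset h (mset [1..<Suc n]) = H" using xs by (metis mset_map)
  then have h: "image_mset h (mset_set {1..n}) = H"
    by (simp add: atLeastLessThanSuc_atLeastAtMost del: upt_Suc)
  have "Min ((\<lambda>\<sigma>. (1 / real n) * (\<Sum>i=1..n. d (h i + g) (h (\<sigma> i)))) ` {\<sigma>. \<sigma> permutes {1..n}}) < \<epsilon>"
    if g: "g \<in> E" for g
  proof -
    have "image_mset (\<lambda>i. h i + g) (mset_set {1..n}) = image_mset (\<lambda>x. x + g) H"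
      unfolding h[symmetric] by (simp add: image_mset.compositionality o_def)
    then obtain \<sigma> where \<sigma>: "\<sigma> permutes {1..n}"
      "(\<Sum>i\<in>{1..n}. d (h i + g) (h (\<sigma> i))) \<le> (\<Sum>(x, y)\<in>#P g. d x y)"
      using permutation_of_flow[OF assms(2), of "{1..n}" "\<lambda>i. h i + g" "P g" h] flow[OF g] h by auto
    \<comment> \<open>Costs are nonnegative, so the bound on the total over \<open>E\<close> holds
      for each single \<open>g\<close>.\<close>
    have "(\<Sum>(x, y)\<in>#P g. d x y) \<le> (\<Sum>g\<in>E. \<Sum>(x, y)\<in>#P g. d x y)"
      using that assms(6) nn by (intro member_le_sum) auto
    then have "(1 / real n) * (\<Sum>i=1..n. d (h i + g) (h (\<sigma> i))) < \<epsilon>"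
      using \<sigma>(2) cost \<open>n \<ge> 1\<close> by (simp add: n_def field_simps)
    then show ?thesis using \<sigma>(1)
      by (subst Min_less_iff) (auto intro: finite_imageI finite_permutations)
  qed
  then show ?thesis using \<open>n \<ge> 1\<close> by blast
qed

end
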